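(* Let $f:\mathbb{R}^n\to\mathbb{R}$ be twice continuously differentiable with a non-empty set of global minimizers, and let $\mathcal{X}=\{x\in\mathbb{R}^n:\nabla f(x)=0,\ \nabla^2 f(x)\succeq 0\}$ be its set of second-order critical points. Suppose that $\nabla^2 f$ is uniformly continuous on $\mathcal{N}(\mathcal{X};\gamma)$ for some $\gamma>0$. Suppose also that there exists $\epsilon>0$ such that $\|x-y\|\ge\epsilon$ for any $x,y\in\mathcal{X}$ with $f(x)\neq f(y)$. Then the following statements are equivalent. (i) There exist scalars $\kappa,\rho>0$ such that $$\operatorname{dist}(x,\mathcal{X})\le\kappa\|\nabla f(x)\|,\quad\forall x\in\mathcal{N}(\mathcal{X};\rho).$$ (ii) There exist scalars $\alpha,\beta>0$ such that $$f(x)\ge f(\hat{x})+\frac{\alpha}{2}\operatorname{dist}^2(x,\mathcal{X}),\quad\forall x\in\mathcal{N}(\mathcal{X};\beta),$$ where $\hat{x}$ denotes a projection of $x$ onto $\mathcal{X}$.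
   Context: $\|\cdot\|$ is the Euclidean norm for vectors and the operator norm for matrices. For a closed set $C\subset\mathbb{R}^n$, $\operatorname{dist}(x,C)$ is the Euclidean distance from $x$ to $C$, and $\mathcal{N}(C;\rho)=\{x\in\mathbb{R}^n:\operatorname{dist}(x,C)\le\rho\}$. A projection of $x$ onto $\mathcal{X}$ is any point $\hat{x}$ minimizing $\|x-z\|$ over $z\in\mathcal{X}$ (it exists since $\mathcal{X}$ is closed and non-empty, and need not be unique). $A\succeq 0$ means that $A$ is positive semidefinite. *)

theory Defs
  imports "HOL-Analysis.Analysis"
begin

definition grad :: "(real ^ 'n \<Rightarrow> real) \<Rightarrow> real ^ 'n \<Rightarrow> real ^ 'n" where
  "grad f x = (THE D. GDERIV f x :> D)"

definition hess :: "(real ^ 'n \<Rightarrow> real) \<Rightarrow> real ^ 'n \<Rightarrow> real ^ 'n ^ 'n" where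
  "hess f x = jacobian (grad f) (at x)"

definition twice_continuously_differentiable :: "(real ^ 'n \<Rightarrow> real) \<Rightarrow> bool" where
  "twice_continuously_differentiable f \<longleftrightarrow>
     (\<forall>x. f differentiable (at x)) \<and>
     (\<forall>x. grad f differentiable (at x)) \<and>
     continuous_on UNIV (hess f)"

definition pos_semidef :: "real ^ 'n ^ 'n \<Rightarrow> bool" where
  "pos_semidef A \<longleftrightarrow> transpose A = A \<and> (\<forall>v. 0 \<le> v \<bullet> (A *v v))"

definition second_order_critical :: "(real ^ 'n \<Rightarrow> real) \<Rightarrow> (real ^ 'n) set" where
  "second_order_critical f = {x. grad f x = 0 \<and> pos_semidef (hess f x)}"

text \<open>The library norm on the matrix type is not the operator norm. Matrices are therefore
  viewed as bounded linear maps wherever a matrix norm is involved.\<close>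

definition matrix_operator :: "real ^ 'n ^ 'n \<Rightarrow> (real ^ 'n) \<Rightarrow>\<^sub>L (real ^ 'n)" where
  "matrix_operator A = Blinfun (\<lambda>v. A *v v)"

lemma matrix_operator_apply: "blinfun_apply (matrix_operator A) v = A *v v"
  unfolding matrix_operator_def
  by (simp add: bounded_linear_Blinfun_apply)

lemma norm_matrix_operator: "norm (matrix_operator A) = onorm (\<lambda>v. A *v v)"
  unfolding norm_blinfun.rep_eq
  by (rule arg_cong[where f = onorm], rule ext, rule matrix_operator_apply)

definition dist_nbhd :: "(real ^ 'n) set \<Rightarrow> real \<Rightarrow> (real ^ 'n) set" where
  "dist_nbhd C r = {x. infdist x C \<le> r}"

definition is_projection :: "(real ^ 'n) set \<Rightarrow> real ^ 'n \<Rightarrow> real ^ 'n \<Rightarrow> bool" where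
  "is_projection C x p \<longleftrightarrow> is_arg_min (\<lambda>z. norm (x - z)) (\<lambda>z. z \<in> C) p"

end

theory Submission
  imports Defs
begin

text \<open>Both implications rest on one uniform estimate. At a point \<open>p\<close> of \<open>X\<close> the Hessian is positive
  semidefinite, so by uniform continuity there is, for every \<open>\<eta> > 0\<close>, a radius \<open>\<delta>\<close> independent
  of \<open>p\<close> such that the Hessian is bounded below by \<open>-\<eta>\<close> on the ball of radius \<open>\<delta>\<close> around \<open>p\<close>.
  Hence \<open>f\<close> lies above each of its tangents up to an error \<open>\<eta>/2 * norm (y - x)\<^sup>2\<close> on that ball
  (\<open>almost_convex_near_critical\<close>).

  Growth implies the error bound: let \<open>p\<close> be a projection of \<open>x\<close> and \<open>d = dist(x, X)\<close>. The tangent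
  at \<open>x\<close>, evaluated at \<open>p\<close>, bounds \<open>f x - f p\<close> by \<open>norm (grad f x) * d + \<eta>/2 * d\<^sup>2\<close>, while growth
  gives at least \<open>\<alpha>/2 * d\<^sup>2\<close>. With \<open>\<eta> = \<alpha>/2\<close> a gradient of size at least \<open>\<alpha>/4 * d\<close> remains.

  The error bound implies growth: the tangent at a point of \<open>X\<close> is horizontal, so near \<open>X\<close> the
  function is at least its value at a projection, minus \<open>\<eta>/2\<close> times the squared distance. These
  values agree for nearby points because of the separation of the critical values. If growth failed
  at \<open>x\<close>, then \<open>f x\<close> would exceed the infimum of \<open>f\<close> on the ball of radius \<open>d/2\<close> around \<open>x\<close> by at
  most \<open>(\<alpha>/2 + 2 * \<eta>) * d\<^sup>2\<close>, with \<open>\<alpha>\<close> and \<open>\<eta>\<close> small compared to \<open>1/\<kappa>\<close>. A penalty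
  argument in the spirit of Ekeland's principle
  (\<open>almost_min_imp_small_gradient\<close>) then yields a point of that ball with gradient a small multiple
  of \<open>d\<close>. Its distance to \<open>X\<close> is still at least \<open>d/2\<close>, contradicting the error bound. In this
  argument no eigenvalue of the Hessian has to be bounded from above, which matters because \<open>X\<close> may
  be unbounded.\<close>

section \<open>Gradient and Hessian\<close>

lemma gderiv_grad:
  fixes f :: "real ^ 'n \<Rightarrow> real"
  assumes "f differentiable (at x)"
  shows "GDERIV f x :> grad f x"
proof -
  obtain f' where f': "(f has_derivative f') (at x)"
    using assms unfolding differentiable_def by blast
  interpret bounded_linear f' using f' by (rule has_derivative_bounded_linear)
  have "f' = (\<lambda>h. h \<bullet> (\<Sum>b\<in>Basis. f' b *\<^sub>R b))"
  proof
    fix h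
    have "f' h = f' (\<Sum>b\<in>Basis. (h \<bullet> b) *\<^sub>R b)" by (simp add: euclidean_representation)
    then show "f' h = h \<bullet> (\<Sum>b\<in>Basis. f' b *\<^sub>R b)"
      by (simp add: sum scaleR inner_sum_right mult.commute)
  qed
  then have ex: "GDERIV f x :> (\<Sum>b\<in>Basis. f' b *\<^sub>R b)"
    using f' unfolding gderiv_def by simp
  have unique: "D = E" if "GDERIV f x :> D" "GDERIV f x :> E" for D E
  proof -
    have "(\<lambda>h. h \<bullet> D) = (\<lambda>h. h \<bullet> E)"
      using that unfolding gderiv_def by (rule has_derivative_unique)
    then have "\<forall>h. h \<bullet> D = h \<bullet> E" by meson
    then show "D = E" by (simp add: vector_eq_ldot)
  qed
  show ?thesis
    unfolding grad_def by (rule theI[where P = "gderiv f x", OF ex unique[OF _ ex]])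
qed

lemma closed_second_order_critical:
  assumes "twice_continuously_differentiable f"
  shows "closed (second_order_critical f)"
proof -
  have g: "continuous_on UNIV (grad f)"
    using assms unfolding twice_continuously_differentiable_def
    by (simp add: continuous_on_eq_continuous_within differentiable_imp_continuous_within)
  have h: "continuous_on UNIV (hess f)"
    using assms unfolding twice_continuously_differentiable_def by simp
  have t: "continuous_on UNIV (\<lambda>x. transpose (hess f x))"
    unfolding transpose_def by (intro continuous_intros h)
  have q: "continuous_on UNIV (\<lambda>x. v \<bullet> (hess f x *v v))" for v
    unfolding matrix_vector_mult_def by (intro continuous_intros h)
  show ?thesis
    unfolding second_order_critical_def pos_semidef_def
    by (intro closed_Collect_conj closed_Collect_all closed_Collect_eq closed_Collect_le
        g t h q continuous_on_const)
qed

section \<open>Lower bounds from the Hessian\<close>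

lemma above_tangent_of_hessian_lower_bound:
  fixes f :: "real ^ 'n \<Rightarrow> real"
  assumes "twice_continuously_differentiable f"
    and H: "\<And>t. 0 \<le> t \<Longrightarrow> t \<le> 1 \<Longrightarrow> - \<eta> * (norm v)\<^sup>2 \<le> v \<bullet> (hess f (x + t *\<^sub>R v) *v v)"
  shows "f x + grad f x \<bullet> v - \<eta> / 2 * (norm v)\<^sup>2 \<le> f (x + v)"
proof -
  define N where "N = \<eta> * (norm v)\<^sup>2"
  define \<phi> where "\<phi> t = f (x + t *\<^sub>R v) + N * t\<^sup>2 / 2" for t
  define \<phi>' where "\<phi>' t = v \<bullet> grad f (x + t *\<^sub>R v) + N * t" for t
  define \<phi>'' where "\<phi>'' t = v \<bullet> (hess f (x + t *\<^sub>R v) *v v) + N" for t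
  have line: "((\<lambda>t. x + t *\<^sub>R v) has_derivative (\<lambda>h. h *\<^sub>R v)) (at t)" for t
    by (auto intro!: derivative_eq_intros)
  have df: "(f has_derivative (\<lambda>h. h \<bullet> grad f y)) (at y)" for y
    using gderiv_grad[of f y] assms(1)
    unfolding gderiv_def twice_continuously_differentiable_def by blast
  have dg: "(grad f has_derivative (\<lambda>h. hess f y *v h)) (at y)" for y
    using assms(1) jacobian_works[of "grad f" "at y"]
    unfolding twice_continuously_differentiable_def hess_def by blast
  have "((\<lambda>t. f (x + t *\<^sub>R v)) has_derivative (\<lambda>h. (h *\<^sub>R v) \<bullet> grad f (x + t *\<^sub>R v))) (at t)" for t
    using has_derivative_compose[OF line df] .
  then have "((\<lambda>t. f (x + t *\<^sub>R v)) has_real_derivative v \<bullet> grad f (x + t *\<^sub>R v)) (at t)" for t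
    unfolding has_field_derivative_def by (simp add: mult_commute_abs)
  then have 1: "DERIV \<phi> t :> \<phi>' t" for t
    unfolding \<phi>_def \<phi>'_def by (auto intro!: derivative_eq_intros)
  have "((\<lambda>t. v \<bullet> grad f (x + t *\<^sub>R v)) has_derivative
      (\<lambda>h. v \<bullet> (hess f (x + t *\<^sub>R v) *v (h *\<^sub>R v)))) (at t)" for t
    using has_derivative_inner_right[OF has_derivative_compose[OF line dg]] .
  then have "((\<lambda>t. v \<bullet> grad f (x + t *\<^sub>R v)) has_real_derivative
      v \<bullet> (hess f (x + t *\<^sub>R v) *v v)) (at t)" for t
    unfolding has_field_derivative_def
    by (simp add: matrix_vector_mult_scaleR mult_commute_abs)
  then have 2: "DERIV \<phi>' t :> \<phi>'' t" for t
    unfolding \<phi>'_def \<phi>''_def by (auto intro!: derivative_eq_intros)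
  have 3: "0 \<le> \<phi>'' t" if "t \<in> {0..1}" for t
    using H[of t] that by (simp add: \<phi>''_def N_def)
  have "\<phi>' 0 * (1 - 0) \<le> \<phi> 1 - \<phi> 0"
    by (rule f''_imp_f'[of "{0..1}" \<phi> \<phi>' \<phi>'']) (use 1 2 3 in auto)
  then show ?thesis
    by (simp add: \<phi>_def \<phi>'_def N_def inner_commute)
qed

text \<open>The radius \<open>\<delta>\<close> does not depend on \<open>p\<close>; this is where uniform continuity of the Hessian in
  the operator norm enters.\<close>

lemma almost_convex_near_critical:
  fixes f :: "real ^ 'n \<Rightarrow> real"
  defines "X \<equiv> second_order_critical f"
  assumes "twice_continuously_differentiable f"
    and "\<gamma> > 0"
    and "uniformly_continuous_on (dist_nbhd X \<gamma>) (\<lambda>x. matrix_operator (hess f x))"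
    and "\<eta> > 0"
  obtains \<delta> where "\<delta> > 0"
    and "\<And>p x y. p \<in> X \<Longrightarrow> dist p x \<le> \<delta> \<Longrightarrow> dist p y \<le> \<delta> \<Longrightarrow>
      f x + grad f x \<bullet> (y - x) - \<eta> / 2 * (norm (y - x))\<^sup>2 \<le> f y"
proof -
  obtain d where d: "d > 0" and
    close: "\<And>x x'. x \<in> dist_nbhd X \<gamma> \<Longrightarrow> x' \<in> dist_nbhd X \<gamma> \<Longrightarrow> dist x' x < d \<Longrightarrow>
      dist (matrix_operator (hess f x')) (matrix_operator (hess f x)) < \<eta>"
    using assms(4,5) unfolding uniformly_continuous_on_def by metis
  define \<delta> where "\<delta> = min \<gamma> (d / 2)"
  have \<delta>: "\<delta> > 0" "\<delta> \<le> \<gamma>" "\<delta> < d"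
    using d \<open>\<gamma> > 0\<close> by (auto simp: \<delta>_def)
  have hess_bound: "- \<eta> * (norm v)\<^sup>2 \<le> v \<bullet> (hess f z *v v)"
    if p: "p \<in> X" and z: "dist p z \<le> \<delta>" for p z v
  proof -
    define E where "E = matrix_operator (hess f z) - matrix_operator (hess f p)"
    have "infdist z X \<le> dist z p" "infdist p X = 0"
      using p by (auto intro: infdist_le)
    then have "z \<in> dist_nbhd X \<gamma>" "p \<in> dist_nbhd X \<gamma>"
      using z \<delta> \<open>\<gamma> > 0\<close> by (auto simp: dist_nbhd_def dist_commute)
    then have E: "norm E \<le> \<eta>"
      using close[of p z] z \<delta> by (simp add: E_def dist_norm norm_minus_commute)
    have "\<bar>v \<bullet> blinfun_apply E v\<bar> \<le> norm v * (norm E * norm v)"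
      by (meson Cauchy_Schwarz_ineq2 mult_left_mono norm_blinfun norm_ge_zero order_trans)
    also have "\<dots> \<le> norm v * (\<eta> * norm v)"
      using E by (intro mult_left_mono mult_right_mono) auto
    finally have "- \<eta> * (norm v)\<^sup>2 \<le> v \<bullet> blinfun_apply E v"
      by (simp add: power2_eq_square algebra_simps)
    moreover have "v \<bullet> blinfun_apply E v = v \<bullet> (hess f z *v v) - v \<bullet> (hess f p *v v)"
      by (simp add: E_def blinfun.diff_left matrix_operator_apply inner_diff_right)
    moreover have "0 \<le> v \<bullet> (hess f p *v v)"
      using p by (simp add: X_def second_order_critical_def pos_semidef_def)
    ultimately show ?thesis by linarith
  qed
  show thesis
  proof (rule that[OF \<delta>(1)])
    fix p x y assume p: "p \<in> X" and xy: "dist p x \<le> \<delta>" "dist p y \<le> \<delta>"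
    have "dist p (x + t *\<^sub>R (y - x)) \<le> \<delta>" if "0 \<le> t" "t \<le> 1" for t
    proof -
      have "(1 - t) *\<^sub>R x + t *\<^sub>R y \<in> cball p \<delta>"
        using that xy by (intro convexD[OF convex_cball]) auto
      then show ?thesis by (simp add: algebra_simps)
    qed
    then have "f x + grad f x \<bullet> (y - x) - \<eta> / 2 * (norm (y - x))\<^sup>2 \<le> f (x + (y - x))"
      using hess_bound[OF p] by (intro above_tangent_of_hessian_lower_bound assms) auto
    then show "f x + grad f x \<bullet> (y - x) - \<eta> / 2 * (norm (y - x))\<^sup>2 \<le> f y" by simp
  qed
qed

section \<open>Almost minimizers and small gradients\<close>

text \<open>A smooth finite-dimensional form of Ekeland's principle: the quadratic penalty
  \<open>G / r\<^sup>2 * norm (y - x)\<^sup>2\<close> is as large as the gap \<open>G\<close> on the boundary of the ball, so the penalized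
  function attains its minimum in the interior, where its gradient vanishes.\<close>

lemma almost_min_imp_small_gradient:
  fixes f :: "real ^ 'n \<Rightarrow> real"
  assumes diff: "\<And>y. f differentiable (at y)"
    and "r > 0" and "G > 0"
    and gap: "\<And>y. dist x y \<le> r \<Longrightarrow> f x - G < f y"
  obtains z where "dist x z < r" and "norm (grad f z) \<le> 2 * G / r"
proof -
  define c where "c = G / r\<^sup>2"
  define g where "g y = f y + c * ((y - x) \<bullet> (y - x))" for y
  have c: "c > 0" using assms by (simp add: c_def)
  have "continuous_on UNIV f"
    using diff by (simp add: continuous_on_eq_continuous_within differentiable_imp_continuous_within)
  then have "continuous_on (cball x r) g"
    unfolding g_def by (intro continuous_intros) (auto intro: continuous_on_subset)
  then obtain z where z: "z \<in> cball x r" and zmin: "\<And>y. y \<in> cball x r \<Longrightarrow> g z \<le> g y"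
    using continuous_attains_inf[of "cball x r" g] \<open>r > 0\<close> by auto
  have interior: "dist x z < r"
  proof (rule ccontr)
    assume "\<not> dist x z < r"
    then have "norm (z - x) = r" using z by (simp add: dist_norm norm_minus_commute)
    then have "g z = f z + G"
      using \<open>r > 0\<close> by (simp add: g_def c_def dot_square_norm)
    moreover have "g z \<le> f x" using zmin[of x] \<open>r > 0\<close> by (simp add: g_def)
    moreover have "f x - G < f z" using gap z by simp
    ultimately show False by linarith
  qed
  have df: "(f has_derivative (\<lambda>h. h \<bullet> grad f z)) (at z)"
    using gderiv_grad[OF diff] unfolding gderiv_def .
  have dg: "(g has_derivative (\<lambda>h. h \<bullet> (grad f z + (2 * c) *\<^sub>R (z - x)))) (at z)"
    unfolding g_def
    by (rule derivative_eq_intros df refl | simp)+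
      (auto simp: algebra_simps inner_commute)
  have "(\<lambda>h. h \<bullet> (grad f z + (2 * c) *\<^sub>R (z - x))) = (\<lambda>h. 0)"
    by (rule differential_zero_maxmin[OF _ open_ball dg])
      (use interior zmin in \<open>auto simp: less_imp_le\<close>)
  then have "grad f z + (2 * c) *\<^sub>R (z - x) = 0"
    using inner_eq_zero_iff by metis
  then have "grad f z = - ((2 * c) *\<^sub>R (z - x))"
    by (simp add: add_eq_0_iff2)
  then have "norm (grad f z) = 2 * c * norm (z - x)" using c by simp
  also have "\<dots> \<le> 2 * c * r"
    using interior c by (intro mult_left_mono) (auto simp: dist_norm norm_minus_commute)
  also have "\<dots> = 2 * G / r" using \<open>r > 0\<close> by (simp add: c_def power2_eq_square)
  finally show thesis using interior that by blast
qed

section \<open>Error bound and quadratic growth\<close>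

lemma is_projection_iff:
  assumes "closed C"
  shows "is_projection C x p \<longleftrightarrow> p \<in> C \<and> dist x p = infdist x C"
proof (intro iffI conjI; (elim conjE)?)
  assume p: "is_projection C x p"
  show "p \<in> C"
    using p unfolding is_projection_def is_arg_min_def by blast
  then have ne: "C \<noteq> {}" by blast
  obtain q where q: "q \<in> C" "infdist x C = dist x q"
    using infdist_attains_inf[OF assms ne] by blast
  then have "\<not> dist x q < dist x p"
    using p unfolding is_projection_def is_arg_min_def dist_norm by blast
  then show "dist x p = infdist x C"
    using infdist_le[OF \<open>p \<in> C\<close>, of x] q(2) by linarith
next
  assume p: "p \<in> C" "dist x p = infdist x C"
  have "\<not> dist x q < dist x p" if "q \<in> C" for q
    using infdist_le[OF that, of x] p(2) by linarith
  then show "is_projection C x p"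
    using p(1) unfolding is_projection_def is_arg_min_def dist_norm by blast
qed

lemma error_bound_if_quadratic_growth:
  fixes f :: "real ^ 'n \<Rightarrow> real"
  defines "X \<equiv> second_order_critical f"
  assumes f: "twice_continuously_differentiable f"
    and \<gamma>: "\<gamma> > 0" "uniformly_continuous_on (dist_nbhd X \<gamma>) (\<lambda>x. matrix_operator (hess f x))"
    and "\<alpha> > 0" and "\<beta> > 0"
    and growth: "\<And>x p. x \<in> dist_nbhd X \<beta> \<Longrightarrow> is_projection X x p \<Longrightarrow>
      f p + \<alpha> / 2 * (infdist x X)\<^sup>2 \<le> f x"
  shows "\<exists>\<kappa>>0. \<exists>\<rho>>0. \<forall>x\<in>dist_nbhd X \<rho>. infdist x X \<le> \<kappa> * norm (grad f x)"
proof (cases "X = {}")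
  case True
  \<comment> \<open>The distance to the empty set is \<open>0\<close> by convention.\<close>
  then show ?thesis by (auto simp: infdist_def intro!: exI[of _ 1])
next
  case False
  have cl: "closed X" unfolding X_def using f by (rule closed_second_order_critical)
  obtain \<delta> where "\<delta> > 0" and tangent: "\<And>p x y. p \<in> X \<Longrightarrow> dist p x \<le> \<delta> \<Longrightarrow> dist p y \<le> \<delta> \<Longrightarrow>
      f x + grad f x \<bullet> (y - x) - \<alpha> / 2 / 2 * (norm (y - x))\<^sup>2 \<le> f y"
    using almost_convex_near_critical[OF f, of \<gamma> "\<alpha> / 2"] \<gamma> \<open>\<alpha> > 0\<close> unfolding X_def by auto
  have "infdist x X \<le> 4 / \<alpha> * norm (grad f x)" if x: "x \<in> dist_nbhd X (min \<beta> \<delta>)" for x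
  proof -
    obtain p where p: "p \<in> X" "infdist x X = dist x p"
      using infdist_attains_inf[OF cl False] by blast
    define d where "d = dist x p"
    have d: "norm (p - x) = d" by (simp add: d_def dist_norm norm_minus_commute)
    have "f p + \<alpha> / 2 * d\<^sup>2 \<le> f x"
      using growth[of x p] x p is_projection_iff[OF cl, of x p]
      by (simp add: dist_nbhd_def d_def)
    moreover have "f x + grad f x \<bullet> (p - x) - \<alpha> / 2 / 2 * d\<^sup>2 \<le> f p"
      using tangent[of p x p] p x \<open>\<delta> > 0\<close> d by (simp add: dist_nbhd_def dist_commute)
    moreover have "- (grad f x \<bullet> (p - x)) \<le> norm (grad f x) * d"
      using Cauchy_Schwarz_ineq2[of "grad f x" "p - x"] d by simp
    ultimately have "\<alpha> / 4 * d\<^sup>2 \<le> norm (grad f x) * d" by (simp add: field_simps)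
    then have "(\<alpha> / 4 * d) * d \<le> norm (grad f x) * d" by (simp add: power2_eq_square)
    then have "d = 0 \<or> \<alpha> / 4 * d \<le> norm (grad f x)"
      by (metis d_def mult_right_le_imp_le zero_le_dist order_le_less)
    then have "d \<le> 4 / \<alpha> * norm (grad f x)"
      using \<open>\<alpha> > 0\<close> by (auto simp: field_simps)
    then show ?thesis using p by (simp add: d_def)
  qed
  then show ?thesis
    using \<open>\<alpha> > 0\<close> \<open>\<beta> > 0\<close> \<open>\<delta> > 0\<close>
    by (intro exI[of _ "4 / \<alpha>"] conjI exI[of _ "min \<beta> \<delta>"]) auto
qed

lemma quadratic_growth_if_error_bound:
  fixes f :: "real ^ 'n \<Rightarrow> real"
  defines "X \<equiv> second_order_critical f"
  assumes f: "twice_continuously_differentiable f"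
    and \<gamma>: "\<gamma> > 0" "uniformly_continuous_on (dist_nbhd X \<gamma>) (\<lambda>x. matrix_operator (hess f x))"
    and "\<epsilon> > 0" and sep: "\<And>x y. x \<in> X \<Longrightarrow> y \<in> X \<Longrightarrow> f x \<noteq> f y \<Longrightarrow> \<epsilon> \<le> norm (x - y)"
    and "\<kappa> > 0" and "\<rho> > 0"
    and eb: "\<And>x. x \<in> dist_nbhd X \<rho> \<Longrightarrow> infdist x X \<le> \<kappa> * norm (grad f x)"
  shows "\<exists>\<alpha>>0. \<exists>\<beta>>0. \<forall>x\<in>dist_nbhd X \<beta>. \<forall>p. is_projection X x p \<longrightarrow>
    f x \<ge> f p + \<alpha> / 2 * (infdist x X)\<^sup>2"
proof -
  have cl: "closed X" unfolding X_def using f by (rule closed_second_order_critical)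
  \<comment> \<open>With \<open>\<eta> = \<alpha>\<close> the gap below is \<open>5 / 2 * \<alpha> * d\<^sup>2\<close> and the ball has radius \<open>d / 2\<close>, so the gradient obtained
    is at most \<open>10 * \<alpha> * d\<close>; the factor \<open>1 / 40\<close> makes \<open>\<kappa>\<close> times this smaller than \<open>d / 2\<close>.\<close>
  define \<alpha> where "\<alpha> = 1 / (40 * \<kappa>)"
  have "\<alpha> > 0" using \<open>\<kappa> > 0\<close> by (simp add: \<alpha>_def)
  obtain \<delta> where "\<delta> > 0" and tangent: "\<And>p x y. p \<in> X \<Longrightarrow> dist p x \<le> \<delta> \<Longrightarrow> dist p y \<le> \<delta> \<Longrightarrow>
      f x + grad f x \<bullet> (y - x) - \<alpha> / 2 * (norm (y - x))\<^sup>2 \<le> f y"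
    using almost_convex_near_critical[OF f, of \<gamma> \<alpha>] \<gamma> \<open>\<alpha> > 0\<close> unfolding X_def by auto
  have critical: "f p - \<alpha> / 2 * (dist p y)\<^sup>2 \<le> f y" if "p \<in> X" "dist p y \<le> \<delta>" for p y
    using tangent[of p p y] that \<open>\<delta> > 0\<close>
    by (simp add: X_def second_order_critical_def dist_norm norm_minus_commute)
  define \<beta> where "\<beta> = Min {\<rho> / 2, \<delta> / 2, \<epsilon> / 4}"
  have \<beta>: "\<beta> > 0" "2 * \<beta> \<le> \<rho>" "2 * \<beta> \<le> \<delta>" "4 * \<beta> \<le> \<epsilon>"
    using \<open>\<rho> > 0\<close> \<open>\<delta> > 0\<close> \<open>\<epsilon> > 0\<close> by (auto simp: \<beta>_def min_def)
  have "f p + \<alpha> / 2 * (infdist x X)\<^sup>2 \<le> f x"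
    if x: "x \<in> dist_nbhd X \<beta>" and proj: "is_projection X x p" for x p
  proof (rule ccontr)
    assume fails: "\<not> ?thesis"
    define d where "d = infdist x X"
    have p: "p \<in> X" "dist x p = d"
      using proj is_projection_iff[OF cl] by (auto simp: d_def)
    have d: "0 < d" "d \<le> \<beta>"
    proof -
      have "d \<noteq> 0"
        using fails p by (auto simp flip: d_def)
      then show "0 < d" unfolding d_def using infdist_nonneg[of x X] by linarith
      show "d \<le> \<beta>" using x by (simp add: dist_nbhd_def d_def)
    qed
    have gap: "f x - 5 / 2 * \<alpha> * d\<^sup>2 < f y" if y: "dist x y \<le> d / 2" for y
    proof -
      obtain q where q: "q \<in> X" "infdist y X = dist y q"
        using infdist_attains_inf[OF cl] p by blast
      have "dist y q \<le> dist y p" using infdist_le[OF p(1), of y] q by simp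
      also have "\<dots> \<le> 2 * d"
        using dist_triangle[of y p x] y p d by (simp add: dist_commute)
      finally have yq: "dist q y \<le> 2 * d" by (simp add: dist_commute)
      have "dist p q \<le> dist p x + dist x y + dist y q"
        using dist_triangle[of p q x] dist_triangle[of x q y] by linarith
      then have "dist p q < \<epsilon>"
        using yq y p d \<beta> by (simp add: dist_commute)
      then have "f q = f p" using sep[OF p(1) q(1)] by (metis dist_norm not_less)
      then have "f p - \<alpha> / 2 * (dist q y)\<^sup>2 \<le> f y"
        using critical[of q y] q yq d \<beta> by simp
      moreover have "\<alpha> / 2 * (dist q y)\<^sup>2 \<le> \<alpha> / 2 * (2 * d)\<^sup>2"
        using yq \<open>\<alpha> > 0\<close> by (intro mult_left_mono power_mono) auto
      moreover have "f x < f p + \<alpha> / 2 * d\<^sup>2" using fails by (simp add: d_def)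
      ultimately show ?thesis by (simp add: power_mult_distrib)
    qed
    obtain z where z: "dist x z < d / 2" "norm (grad f z) \<le> 2 * (5 / 2 * \<alpha> * d\<^sup>2) / (d / 2)"
    proof (rule almost_min_imp_small_gradient[of f "d / 2" "5 / 2 * \<alpha> * d\<^sup>2" x])
      show "f differentiable (at y)" for y
        using f by (simp add: twice_continuously_differentiable_def)
    qed (use gap d \<open>\<alpha> > 0\<close> in auto)
    have grad: "norm (grad f z) \<le> 10 * \<alpha> * d"
      using z(2) d by (simp add: power2_eq_square)
    have "infdist z X \<le> dist z p" using p by (simp add: infdist_le)
    then have "infdist z X \<le> \<rho>"
      using dist_triangle[of z p x] z p d \<beta> by (simp add: dist_commute)
    then have "infdist z X \<le> \<kappa> * norm (grad f z)" using eb by (simp add: dist_nbhd_def)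
    also have "\<dots> \<le> \<kappa> * (10 * \<alpha> * d)" using grad \<open>\<kappa> > 0\<close> by simp
    also have "\<dots> = d / 4" using \<open>\<kappa> > 0\<close> by (simp add: \<alpha>_def)
    finally have "infdist z X \<le> d / 4" .
    moreover have "d \<le> infdist z X + dist x z"
      unfolding d_def by (rule infdist_triangle)
    ultimately show False using z d by linarith
  qed
  then show ?thesis using \<open>\<alpha> > 0\<close> \<beta>(1) by blast
qed

theorem theorem1:
  fixes f :: "real ^ 'n \<Rightarrow> real"
    and X :: "(real ^ 'n) set"
  defines "X \<equiv> second_order_critical f"
  assumes "twice_continuously_differentiable f"
    and "\<exists>x0. \<forall>x. f x0 \<le> f x"
    and "\<exists>\<gamma>>0. uniformly_continuous_on (dist_nbhd X \<gamma>) (\<lambda>x. matrix_operator (hess f x))"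
    and "\<exists>\<epsilon>>0. \<forall>x\<in>X. \<forall>y\<in>X. f x \<noteq> f y \<longrightarrow> norm (x - y) \<ge> \<epsilon>"
  shows "(\<exists>\<kappa>>0. \<exists>\<rho>>0. \<forall>x\<in>dist_nbhd X \<rho>. infdist x X \<le> \<kappa> * norm (grad f x))
     \<longleftrightarrow> (\<exists>\<alpha>>0. \<exists>\<beta>>0. \<forall>x\<in>dist_nbhd X \<beta>. \<forall>xhat. is_projection X x xhat \<longrightarrow>
            f x \<ge> f xhat + \<alpha> / 2 * (infdist x X)\<^sup>2)"
proof -
  obtain \<gamma> where \<gamma>: "\<gamma> > 0"
    "uniformly_continuous_on (dist_nbhd X \<gamma>) (\<lambda>x. matrix_operator (hess f x))"
    using assms(4) by blast
  obtain \<epsilon> where \<epsilon>: "\<epsilon> > 0"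
    "\<And>x y. x \<in> X \<Longrightarrow> y \<in> X \<Longrightarrow> f x \<noteq> f y \<Longrightarrow> \<epsilon> \<le> norm (x - y)"
    using assms(5) by blast
  show ?thesis
  proof (intro iffI; elim exE conjE)
    fix \<kappa> \<rho> :: real
    assume "\<kappa> > 0" "\<rho> > 0" "\<forall>x\<in>dist_nbhd X \<rho>. infdist x X \<le> \<kappa> * norm (grad f x)"
    then show "\<exists>\<alpha>>0. \<exists>\<beta>>0. \<forall>x\<in>dist_nbhd X \<beta>. \<forall>xhat. is_projection X x xhat \<longrightarrow>
        f x \<ge> f xhat + \<alpha> / 2 * (infdist x X)\<^sup>2"
      using quadratic_growth_if_error_bound[of f \<gamma> \<epsilon> \<kappa> \<rho>] assms(2) \<gamma> \<epsilon> unfolding X_def by blast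
  next
    fix \<alpha> \<beta> :: real
    assume "\<alpha> > 0" "\<beta> > 0" "\<forall>x\<in>dist_nbhd X \<beta>. \<forall>xhat. is_projection X x xhat \<longrightarrow>
      f x \<ge> f xhat + \<alpha> / 2 * (infdist x X)\<^sup>2"
    then show "\<exists>\<kappa>>0. \<exists>\<rho>>0. \<forall>x\<in>dist_nbhd X \<rho>. infdist x X \<le> \<kappa> * norm (grad f x)"
      using error_bound_if_quadratic_growth[of f \<gamma> \<alpha> \<beta>] assms(2) \<gamma> unfolding X_def by blast
  qed
qed

end
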